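(* Let $\mathbf{L}=\langle L,\leq\rangle$ be a complete lattice and $S$ an $L$-parameterization. An operator $C\colon L\to L$ is an $S$-closure operator in $\mathbf{L}$ if and only if it satisfies $a\leq C(a)$ and $C(C(a))\leq C(a)$ for all $a\in L$, and, for all $a,b\in L$ and all $\langle f,h\rangle\in S$, $a\leq h(b)$ implies $C(a)\leq h(C(b))$.
   Context: An isotone Galois connection in $\mathbf{L}$ is a pair $\langle f,h\rangle$ of maps $L\to L$ with $f(a)\leq b$ iff $a\leq h(b)$. An $L$-parameterization is a set $S$ of isotone Galois connections containing $\langle\mathrm{id},\mathrm{id}\rangle$. An $S$-closure operator is $C\colon L\to L$ with $a\leq C(a)$, $a\leq b$ implies $C(a)\leq C(b)$, and $C(h(C(a)))\leq h(C(a))$ for all $a,b\in L$ and $\langle f,h\rangle\in S$. *)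

theory Defs
  imports Main
begin

definition isotone_galois_connection :: "('a::order \<Rightarrow> 'a) \<times> ('a \<Rightarrow> 'a) \<Rightarrow> bool" where
  "isotone_galois_connection = (\<lambda>(f, h). \<forall>a b. f a \<le> b \<longleftrightarrow> a \<le> h b)"

definition parameterization :: "(('a::complete_lattice \<Rightarrow> 'a) \<times> ('a \<Rightarrow> 'a)) set \<Rightarrow> bool" where
  "parameterization S \<longleftrightarrow> (\<forall>p\<in>S. isotone_galois_connection p) \<and> (id, id) \<in> S"

definition S_closure_operator ::
  "(('a::complete_lattice \<Rightarrow> 'a) \<times> ('a \<Rightarrow> 'a)) set \<Rightarrow> ('a \<Rightarrow> 'a) \<Rightarrow> bool" where
  "S_closure_operator S C \<longleftrightarrow>
     (\<forall>a. a \<le> C a) \<and>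
     (\<forall>a b. a \<le> b \<longrightarrow> C a \<le> C b) \<and>
     (\<forall>a. \<forall>(f, h)\<in>S. C (h (C a)) \<le> h (C a))"

end

theory Submission
  imports Defs
begin

text \<open>The single implication \<open>a \<le> h b \<longrightarrow> C a \<le> h (C b)\<close>
  packs together isotony and the closedness of each \<open>h (C a)\<close>. The pair
  \<open>(id, id)\<close> in \<open>S\<close> recovers isotony from it, and conversely yields
  idempotence from closedness. The other ingredient is that upper adjoints \<open>h\<close> are
  isotone, so extensivity and idempotence of \<open>C\<close> can be applied under
  \<open>h\<close>.\<close>

text \<open>The counit \<open>f (h a) \<le> a\<close>, weakened to \<open>f (h a) \<le> b\<close>,
  transposes back.\<close>

lemma isotone_galois_connection_mono:
  assumes "isotone_galois_connection (f, h)" and "a \<le> b"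
  shows "h a \<le> h b"
proof -
  have adj: "f x \<le> y \<longleftrightarrow> x \<le> h y" for x y
    using assms(1) by (simp add: isotone_galois_connection_def)
  have "f (h a) \<le> a" by (simp add: adj)
  then have "f (h a) \<le> b" using assms(2) by (rule order_trans)
  then show ?thesis by (simp add: adj)
qed

theorem theorem33:
  fixes S :: "(('a::complete_lattice \<Rightarrow> 'a) \<times> ('a \<Rightarrow> 'a)) set"
    and C :: "'a \<Rightarrow> 'a"
  assumes "parameterization S"
  shows "S_closure_operator S C \<longleftrightarrow>
    (\<forall>a. a \<le> C a) \<and>
    (\<forall>a. C (C a) \<le> C a) \<and>
    (\<forall>a b. \<forall>(f, h)\<in>S. a \<le> h b \<longrightarrow> C a \<le> h (C b))"
proof -
  have id_in: "(id, id) \<in> S"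
    using assms by (simp add: parameterization_def)
  have h_mono: "h a \<le> h b" if "(f, h) \<in> S" "a \<le> b" for f h a b
    using assms that isotone_galois_connection_mono
    unfolding parameterization_def by blast
  show ?thesis
  proof
    assume "S_closure_operator S C"
    then have ext: "a \<le> C a" and mono: "a \<le> b \<Longrightarrow> C a \<le> C b"
      and closed: "(f, h) \<in> S \<Longrightarrow> C (h (C a)) \<le> h (C a)" for a b f h
      unfolding S_closure_operator_def by blast+
    have "C (C a) \<le> C a" for a
      using closed[OF id_in] by simp
    moreover have "C a \<le> h (C b)" if "(f, h) \<in> S" "a \<le> h b" for a b f h
    proof -
      \<comment> \<open>Closedness concerns \<open>h\<close> only at values of \<open>C\<close>, so
        \<open>b\<close> is first enlarged to \<open>C b\<close>.\<close>
      have "a \<le> h (C b)"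
        using that(2) h_mono[OF that(1) ext] by (rule order_trans)
      then have "C a \<le> C (h (C b))" by (rule mono)
      also have "\<dots> \<le> h (C b)" using that(1) by (rule closed)
      finally show ?thesis .
    qed
    ultimately show "(\<forall>a. a \<le> C a) \<and> (\<forall>a. C (C a) \<le> C a) \<and>
        (\<forall>a b. \<forall>(f, h)\<in>S. a \<le> h b \<longrightarrow> C a \<le> h (C b))"
      using ext by blast
  next
    assume "(\<forall>a. a \<le> C a) \<and> (\<forall>a. C (C a) \<le> C a) \<and>
        (\<forall>a b. \<forall>(f, h)\<in>S. a \<le> h b \<longrightarrow> C a \<le> h (C b))"
    then have ext: "a \<le> C a" and idem: "C (C a) \<le> C a"
      and step: "(f, h) \<in> S \<Longrightarrow> a \<le> h b \<Longrightarrow> C a \<le> h (C b)" for a b f h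
      by blast+
    \<comment> \<open>For \<open>h = id\<close> the implication is isotony itself.\<close>
    have "C a \<le> C b" if "a \<le> b" for a b
      using step[OF id_in, of a b] that by simp
    moreover have "C (h (C a)) \<le> h (C a)" if "(f, h) \<in> S" for a f h
      \<comment> \<open>Reflexivity of \<open>h (C a)\<close> as premise gives the bound
        \<open>h (C (C a))\<close>; idempotence under \<open>h\<close> removes the extra
        \<open>C\<close>.\<close>
      using step[OF that order_refl] h_mono[OF that idem] by (rule order_trans)
    ultimately show "S_closure_operator S C"
      using ext unfolding S_closure_operator_def by blast
  qed
qed

end
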